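(* For every positive integer $n$, there exist tree-chains $\mathcal U_1,\mathcal U_2,\ldots,\mathcal U_n$ in $\mathbb R^2$, and functions $\varphi_1:\mathcal U_2\to\mathcal U_1$, $\varphi_2:\mathcal U_3\to\mathcal U_2$, $\ldots$, $\varphi_{n-1}:\mathcal U_n\to\mathcal U_{n-1}$ such that (1) for each $k\in\{1,2,\ldots,n-1\}$, $\mathcal U_{k+1}$ strongly refines $\mathcal U_k$; (2) for each $U\in\mathcal U_1$ and each $V\in\mathcal U_2$, $U\cap V\ne\emptyset\Rightarrow\varphi_1(V)\cap U=\emptyset$; (3) either for each $k\in\{1,2,\ldots,n-2\}$ and all $U\in\mathcal U_{k+2}$ and $V\in\mathcal U_{k+1}$, $$U\cap V\neq\emptyset\Rightarrow\varphi_{k+1}(U)\cap\varphi_k(V)\ne\emptyset,$$ or for each $k\in\{1,2,\ldots,n-2\}$ and all $U\in\mathcal U_{k+2}$ and $V\in\mathcal U_{k+1}$, $$\operatorname{cl}(U)\subseteq V\Rightarrow\varphi_{k+1}(U)\subseteq\varphi_k(V);$$ (4) for each $k\in\{1,2,\ldots,n-1\}$ and all $U,V\in\mathcal U_{k+1}$, $U\cap V\neq\emptyset\Rightarrow\varphi_k(U)\cap\varphi_k(V)\ne\emptyset$.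
   Context: A graph is a continuum (nonempty compact connected metric space) that is a union of finitely many arcs, any two of which are either disjoint or intersect in one or both of their end points; a tree is a graph containing no simple closed curve. A tree-chain in a metric space is a (finite) family of open subsets such that the geometric realization of its nerve is a tree. A family $\mathcal V$ strongly refines a family $\mathcal U$ if for each $V\in\mathcal V$ there is $U\in\mathcal U$ with $\operatorname{cl}(V)\subseteq U$. *)

theory Defs
  imports "HOL-Analysis.Analysis"
begin

definition continuum :: "'a::topological_space set \<Rightarrow> bool" where
  "continuum S \<longleftrightarrow>
     S \<noteq> {} \<and> compact S \<and> connected S \<and> metrizable_space (top_of_set S)"

text \<open>
  Arcs are given by parametrizations. Since a continuum is Hausdorff, \<^term>\<open>path_image g\<close> is
  homeomorphic to the unit interval whenever \<^term>\<open>arc g\<close> holds, with end points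
  \<^term>\<open>pathstart g\<close> and \<^term>\<open>pathfinish g\<close>. The inclusion below also covers disjoint arcs.
  Arcs are nondegenerate, so a one-point space is not a graph.
\<close>

definition topological_graph :: "'a::topological_space set \<Rightarrow> bool" where
  "topological_graph S \<longleftrightarrow>
     continuum S \<and>
     (\<exists>\<A>. finite \<A> \<and> (\<forall>g\<in>\<A>. arc g) \<and> S = (\<Union>g\<in>\<A>. path_image g) \<and>
          (\<forall>g\<in>\<A>. \<forall>h\<in>\<A>. g \<noteq> h \<longrightarrow>
             path_image g \<inter> path_image h
               \<subseteq> {pathstart g, pathfinish g} \<inter> {pathstart h, pathfinish h}))"

definition topological_tree :: "'a::topological_space set \<Rightarrow> bool" where
  "topological_tree S \<longleftrightarrow>
     topological_graph S \<and>
     \<not> (\<exists>g. simple_path g \<and> pathfinish g = pathstart g \<and> path_image g \<subseteq> S)"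

text \<open>An empty member of \<open>\<U>\<close> is not a vertex of the nerve.\<close>

definition nerve :: "'a set set \<Rightarrow> 'a set set set" where
  "nerve \<U> = {\<S>. \<S> \<subseteq> \<U> \<and> finite \<S> \<and> \<S> \<noteq> {} \<and> \<Inter>\<S> \<noteq> {}}"

text \<open>
  Points are given by barycentric coordinates, as a subspace of the function space
  \<open>'v \<Rightarrow> real\<close> with its product topology. For a complex with finitely many vertices, the only
  case used, this is the usual topology of the geometric realization.
\<close>

definition geometric_realization :: "'v set set \<Rightarrow> ('v \<Rightarrow> real) set" where
  "geometric_realization K =
     {t. (\<forall>v. 0 \<le> t v) \<and> {v. t v \<noteq> 0} \<in> K \<and> (\<Sum>v | t v \<noteq> 0. t v) = 1}"

definition tree_chain :: "'a::metric_space set set \<Rightarrow> bool" where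
  "tree_chain \<U> \<longleftrightarrow>
     finite \<U> \<and> (\<forall>U\<in>\<U>. open U) \<and> topological_tree (geometric_realization (nerve \<U>))"

definition strongly_refines :: "'a::topological_space set set \<Rightarrow> 'a set set \<Rightarrow> bool" where
  "strongly_refines \<V> \<U> \<longleftrightarrow> (\<forall>V\<in>\<V>. \<exists>U\<in>\<U>. closure V \<subseteq> U)"

end

theory Submission
  imports Defs
begin

text \<open>
  The finite statement holds because a shift of a line may lose a little of its domain at every
  level. Let \<open>\<U>\<^sub>k\<close> consist of vertical strips of the plane, centred at the integers
  \<open>0, \<dots>, 3 * (n - k) + 1\<close> of the horizontal axis, and let \<open>\<phi>\<^sub>k\<close> send the strip
  centred at \<open>i\<close> to the strip centred at \<open>i + 3\<close>. Each level has three strips fewer than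
  the one before it, so the shifted strip always exists one level up. All strips have half-width
  strictly between \<open>1/2\<close> and \<open>1\<close>; hence two strips, of the same or of different levels, meet if
  and only if their centres differ by at most \<open>1\<close> (\<open>strips_meet_iff\<close>). The conditions on the maps
  \<open>\<phi>\<^sub>k\<close> then only speak about differences of integers. These are preserved by the shift, so
  strips that meet go to strips that meet, within one level and across two consecutive levels.
  A shift by \<open>3\<close> moves every strip off all its neighbours, which lie at distance at most \<open>1\<close>.
  Half-widths that decrease with \<open>k\<close> give strong refinement.

  It remains to see that the nerve of such a linear chain is realized by a tree. Its
  realization is homeomorphic to an interval (\<open>realization_linear_chain_homeomorphic\<close>), and an
  arc contains no simple closed curve, by the intermediate value theorem
  (\<open>no_simple_loop_in_interval\<close>).
\<close>

section \<open>Arcs are trees\<close>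

text \<open>
  A loop in the line passes through every value between \<open>h 0\<close> and \<open>h (1/2)\<close> twice, once on the
  way out and once on the way back.
\<close>

lemma no_simple_loop_in_interval:
  fixes h :: "real \<Rightarrow> real"
  assumes "simple_path h" "pathfinish h = pathstart h"
  shows False
proof -
  have cont: "continuous_on {0..1} h"
    using assms(1) by (simp add: simple_path_def path_def)
  have inj: "x = y \<or> x = 0 \<and> y = 1 \<or> x = 1 \<and> y = 0"
    if "x \<in> {0..1}" "y \<in> {0..1}" "h x = h y" for x y
    using assms(1) that by (auto simp: simple_path_def loop_free_def)
  have loop: "h 1 = h 0"
    using assms(2) by (simp add: pathfinish_def pathstart_def)
  have ne: "h 0 \<noteq> h (1/2)"
    using inj[of 0 "1/2"] by auto
  define y where "y = (h 0 + h (1/2)) / 2"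
  have y: "y \<noteq> h 0" "y \<noteq> h (1/2)"
    using ne by (auto simp: y_def field_simps)
  have *: "y \<in> h ` {0..1/2}" "y \<in> h ` {1/2..1}"
  proof -
    have seg: "y \<in> closed_segment (h 0) (h (1/2))"
      unfolding y_def closed_segment_eq_real_ivl by auto
    have "is_interval (h ` {0..1/2})" "is_interval (h ` {1/2..1})"
      by (auto simp: is_interval_connected_1
          intro!: connected_continuous_image continuous_on_subset[OF cont])
    moreover have "h 0 \<in> h ` {0..1/2}" "h (1/2) \<in> h ` {0..1/2}"
      "h (1/2) \<in> h ` {1/2..1}"
      by auto
    moreover have "h 0 \<in> h ` {1/2..1}"
      by (rule image_eqI[of _ _ 1]) (auto simp: loop)
    ultimately have "closed_segment (h 0) (h (1/2)) \<subseteq> h ` {0..1/2}"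
      "closed_segment (h 0) (h (1/2)) \<subseteq> h ` {1/2..1}"
      by (simp_all add: is_interval_convex_1 closed_segment_subset)
    then show "y \<in> h ` {0..1/2}" "y \<in> h ` {1/2..1}"
      using seg by auto
  qed
  then obtain s t where st: "s \<in> {0..1/2}" "h s = y" "t \<in> {1/2..1}" "h t = y"
    by auto
  then have "s = t \<or> s = 0 \<and> t = 1 \<or> s = 1 \<and> t = 0"
    by (intro inj) auto
  then have "s = 0 \<or> s = 1/2"
    using st by auto
  then show False
    using st y by metis
qed

lemma topological_tree_if_homeomorphic_interval:
  fixes S :: "'a::topological_space set"
  assumes "S homeomorphic {0..1::real}"
  shows "topological_tree S"
proof -
  obtain f g where hom: "homeomorphism {0..1::real} S f g"
    using homeomorphic_sym[THEN iffD1, OF assms] unfolding homeomorphic_def by auto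
  then have f: "continuous_on {0..1} f" "f ` {0..1} = S" and g: "continuous_on S g"
    and gf: "\<And>x. x \<in> {0..1} \<Longrightarrow> g (f x) = x" and fg: "\<And>x. x \<in> S \<Longrightarrow> f (g x) = x"
    by (auto simp: homeomorphism_def)
  have "arc f"
    using f gf by (auto simp: arc_def path_def intro!: inj_on_inverseI[where g = g])
  moreover have "path_image f = S"
    using f by (simp add: path_image_def)
  moreover have "continuum S"
  proof -
    have "homeomorphic_maps (top_of_set {0..1}) (top_of_set S) f g"
      using hom by (auto simp: homeomorphic_maps_def homeomorphism_def)
    then have "top_of_set {0..1::real} homeomorphic_space top_of_set S"
      by (auto simp: homeomorphic_space_def)
    then have "metrizable_space (top_of_set S)"
      by (simp add: metrizable_space_euclidean metrizable_space_subtopology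
          flip: homeomorphic_metrizable_space)
    moreover have "compact S" "connected S"
      using f compact_continuous_image[of "{0..1}" f] connected_continuous_image[of "{0..1}" f]
      by auto
    ultimately show ?thesis
      using f(2) by (auto simp: continuum_def)
  qed
  ultimately have "topological_graph S"
    by (auto simp: topological_graph_def intro!: exI[of _ "{f}"])
  moreover have False
    if h: "simple_path h" "pathfinish h = pathstart h" "path_image h \<subseteq> S" for h
  proof -
    have "inj_on g S"
      using fg by (rule inj_on_inverseI)
    moreover have "continuous_on (path_image h) g"
      using g h(3) continuous_on_subset by blast
    ultimately have "simple_path (g \<circ> h)"
      using h by (blast intro: inj_on_subset simple_path_continuous_image)
    then show False
      using no_simple_loop_in_interval h(2)
      by (metis comp_apply pathfinish_def pathstart_def)
  qed
  ultimately show ?thesis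
    unfolding topological_tree_def by blast
qed

section \<open>The nerve of a linear chain\<close>

locale linear_chain =
  fixes c :: "nat \<Rightarrow> 'a set" and N :: nat
  assumes N: "N \<ge> 1"
    and inj: "inj_on c {..N}"
    and meet: "\<And>i j. i \<le> N \<Longrightarrow> j \<le> N \<Longrightarrow> c i \<inter> c j \<noteq> {} \<longleftrightarrow> i \<le> j + 1 \<and> j \<le> i + 1"
begin

definition edge_point :: "nat \<Rightarrow> real \<Rightarrow> 'a set \<Rightarrow> real" where
  "edge_point i u = (\<lambda>v. if v = c i then 1 - u else if v = c (i + 1) then u else 0)"

text \<open>
  Parametrization of the realization by \<open>{0..N}\<close>: the barycentric coordinates at time \<open>s\<close> are
  the hat functions centred at the integers. Being defined by one formula for all \<open>s\<close>, it is
  continuous without any gluing of edges.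
\<close>

definition chain_point :: "real \<Rightarrow> 'a set \<Rightarrow> real" where
  "chain_point s =
     (\<lambda>v. if v \<in> c ` {..N} then max 0 (1 - \<bar>s - real (inv_into {..N} c v)\<bar>) else 0)"

definition position :: "('a set \<Rightarrow> real) \<Rightarrow> real" where
  "position t = (\<Sum>i\<le>N. real i * t (c i))"

lemma c_eq_iff: "i \<le> N \<Longrightarrow> j \<le> N \<Longrightarrow> c i = c j \<longleftrightarrow> i = j"
  using inj by (auto dest: inj_onD)

text \<open>
  No point lies in three distinct links, so a point of the realization is supported on two consecutive
  ones.
\<close>

lemma realization_eq_edges:
  "geometric_realization (nerve (c ` {..N})) = {edge_point i u |i u. i < N \<and> u \<in> {0..1}}"
proof (intro equalityI subsetI)
  fix t assume t: "t \<in> geometric_realization (nerve (c ` {..N}))"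
  define T where "T = {v. t v \<noteq> 0}"
  have T: "T \<subseteq> c ` {..N}" "T \<noteq> {}" "\<Inter>T \<noteq> {}"
    and nonneg: "\<And>v. 0 \<le> t v" and total: "(\<Sum>v\<in>T. t v) = 1"
    using t by (auto simp: geometric_realization_def nerve_def T_def)
  define I where "I = {i. i \<le> N \<and> c i \<in> T}"
  have fin: "finite I" and "I \<noteq> {}"
    using T by (auto simp: I_def)
  (* The truncation keeps the edge inside the chain when only the last link supports t. *)
  define m where "m = min (Min I) (N - 1)"
  have "m < N"
    using N by (auto simp: m_def)
  have I_sub: "i = m \<or> i = m + 1" if "i \<in> I" for i
  proof -
    have MI: "Min I \<in> I"
      using fin \<open>I \<noteq> {}\<close> by simp
    then have "c i \<inter> c (Min I) \<noteq> {}"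
      using T(3) that unfolding I_def by blast
    then have "i \<le> Min I + 1"
      using meet MI that by (auto simp: I_def)
    moreover have "Min I \<le> i" "i \<le> N"
      using fin that by (auto simp: I_def)
    ultimately show ?thesis
      unfolding m_def by linarith
  qed
  have distinct: "c (m + 1) \<noteq> c m"
    using c_eq_iff[of "m + 1" m] \<open>m < N\<close> by simp
  have T_sub: "T \<subseteq> {c m, c (m + 1)}"
    using T(1) I_sub by (force simp: I_def)
  then have "(\<Sum>v\<in>T. t v) = (\<Sum>v\<in>{c m, c (m + 1)}. t v)"
    by (intro sum.mono_neutral_left) (auto simp: T_def)
  then have one: "t (c m) + t (c (m + 1)) = 1"
    using total distinct by auto
  moreover have "t v = 0" if "v \<noteq> c m" "v \<noteq> c (m + 1)" for v
    using T_sub that by (auto simp: T_def)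
  ultimately have "t = edge_point m (t (c (m + 1)))"
    by (auto simp: edge_point_def fun_eq_iff)
  moreover have "t (c (m + 1)) \<in> {0..1}"
    using one nonneg[of "c m"] nonneg[of "c (m + 1)"] by auto
  ultimately show "t \<in> {edge_point i u |i u. i < N \<and> u \<in> {0..1}}"
    using \<open>m < N\<close> by blast
next
  fix t assume "t \<in> {edge_point i u |i u. i < N \<and> u \<in> {0..1}}"
  then obtain i u where t: "t = edge_point i u" and i: "i < N" and u: "0 \<le> u" "u \<le> 1"
    by auto
  have distinct: "c (i + 1) \<noteq> c i"
    using c_eq_iff[of "i + 1" i] i by simp
  have supp: "{v. t v \<noteq> 0} \<subseteq> {c i, c (i + 1)}"
    by (auto simp: t edge_point_def)
  have "c i \<inter> c (i + 1) \<noteq> {}"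
    using meet[of i "i + 1"] i by simp
  then have "\<Inter>{v. t v \<noteq> 0} \<noteq> {}"
    using supp by auto
  moreover have "{v. t v \<noteq> 0} \<noteq> {}"
  proof -
    have "t (c i) \<noteq> 0 \<or> t (c (i + 1)) \<noteq> 0"
      using distinct by (auto simp: t edge_point_def)
    then show ?thesis
      by blast
  qed
  moreover have "finite {v. t v \<noteq> 0}" "{v. t v \<noteq> 0} \<subseteq> c ` {..N}"
    using supp i by (auto intro: finite_subset)
  moreover have "(\<Sum>v | t v \<noteq> 0. t v) = (\<Sum>v\<in>{c i, c (i + 1)}. t v)"
    using supp by (intro sum.mono_neutral_left) auto
  then have "(\<Sum>v | t v \<noteq> 0. t v) = 1"
    using distinct by (auto simp: t edge_point_def)
  moreover have "\<forall>v. 0 \<le> t v"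
    using u by (auto simp: t edge_point_def)
  ultimately show "t \<in> geometric_realization (nerve (c ` {..N}))"
    unfolding geometric_realization_def nerve_def by blast
qed

lemma chain_point_on_edge:
  assumes "i < N" "u \<in> {0..1}"
  shows "chain_point (real i + u) = edge_point i u"
proof
  fix v
  show "chain_point (real i + u) v = edge_point i u v"
  proof (cases "v \<in> c ` {..N}")
    case True
    then obtain j where j: "j \<le> N" "v = c j"
      by auto
    have "inv_into {..N} c v = j"
      using inj j by simp
    moreover have "c j = c i \<longleftrightarrow> j = i" "c j = c (i + 1) \<longleftrightarrow> j = i + 1"
      using c_eq_iff j assms by auto
    moreover have "j < i \<or> j = i \<or> j = i + 1 \<or> j > i + 1"
      by arith
    ultimately show ?thesis
      using assms j by (auto simp: chain_point_def edge_point_def)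
  next
    case False
    then have "v \<noteq> c i" "v \<noteq> c (i + 1)"
      using assms by auto
    then show ?thesis
      using False by (simp add: chain_point_def edge_point_def)
  qed
qed

lemma position_edge_point:
  assumes "i < N"
  shows "position (edge_point i u) = real i + u"
proof -
  have eq: "c j = c i \<longleftrightarrow> j = i" "c j = c (i + 1) \<longleftrightarrow> j = i + 1" if "j \<le> N" for j
    using c_eq_iff that assms by auto
  have "position (edge_point i u) = (\<Sum>j\<in>{i, i + 1}. real j * edge_point i u (c j))"
    unfolding position_def
    using assms eq by (intro sum.mono_neutral_right) (auto simp: edge_point_def)
  also have "\<dots> = real i * (1 - u) + real (i + 1) * u"
    using assms eq[of "i + 1"] by (simp add: edge_point_def)
  also have "\<dots> = real i + u"
    by (simp add: algebra_simps)
  finally show ?thesis .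
qed

lemma interval_eq_edges:
  "{0..real N} = {real i + u |i u. i < N \<and> u \<in> {0..1}}"
proof (intro equalityI subsetI)
  fix s assume s: "s \<in> {0..real N}"
  define i where "i = min (nat \<lfloor>s\<rfloor>) (N - 1)"
  have fl: "real (nat \<lfloor>s\<rfloor>) \<le> s" "s < real (nat \<lfloor>s\<rfloor>) + 1"
    using s by auto
  have "i < N" "real i \<le> s" "s \<le> real i + 1"
    using N fl s unfolding i_def by (auto simp: min_def of_nat_diff)
  then show "s \<in> {real i + u |i u. i < N \<and> u \<in> {0..1}}"
    by (intro CollectI exI[of _ i] exI[of _ "s - real i"]) auto
qed auto

lemma realization_linear_chain_homeomorphic:
  "geometric_realization (nerve (c ` {..N})) homeomorphic {0..1::real}"
proof -
  let ?R = "geometric_realization (nerve (c ` {..N}))"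
  have "continuous_on {0..real N} chain_point"
    unfolding chain_point_def
  proof (rule continuous_on_coordinatewise_then_product)
    show "continuous_on {0..real N}
        (\<lambda>s. if v \<in> c ` {..N} then max 0 (1 - \<bar>s - real (inv_into {..N} c v)\<bar>) else 0)" for v
      by (cases "v \<in> c ` {..N}") (auto intro!: continuous_intros)
  qed
  moreover have "continuous_on ?R position"
  proof -
    have "continuous_on ?R (\<lambda>t. t v)" for v :: "'a set"
      by (rule continuous_on_subset[OF continuous_on_product_coordinates]) simp
    then show ?thesis
      unfolding position_def by (intro continuous_intros)
  qed
  moreover have "chain_point ` {0..real N} = ?R" "position ` ?R = {0..real N}"
    unfolding realization_eq_edges interval_eq_edges
    by (force simp: chain_point_on_edge position_edge_point)+
  moreover have "position (chain_point s) = s" if "s \<in> {0..real N}" for s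
    using that unfolding interval_eq_edges
    by (auto simp: chain_point_on_edge position_edge_point)
  moreover have "chain_point (position t) = t" if "t \<in> ?R" for t
    using that unfolding realization_eq_edges
    by (auto simp: chain_point_on_edge position_edge_point)
  ultimately have "homeomorphism {0..real N} ?R chain_point position"
    by (simp add: homeomorphism_def)
  then have "?R homeomorphic {0..real N}"
    using homeomorphic_def homeomorphic_sym by blast
  moreover have "{0..real N} homeomorphic {0..1::real}"
    using N by (intro homeomorphic_closed_intervals_real) auto
  ultimately show ?thesis
    by (rule homeomorphic_trans)
qed

end

lemma tree_chain_linear:
  fixes c :: "nat \<Rightarrow> 'a::metric_space set"
  assumes "linear_chain c N" "\<And>i. i \<le> N \<Longrightarrow> open (c i)"
  shows "tree_chain (c ` {..N})"
  using assms topological_tree_if_homeomorphic_interval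
    linear_chain.realization_linear_chain_homeomorphic
  by (auto simp: tree_chain_def)

section \<open>Strips in the plane\<close>

definition strip :: "real \<Rightarrow> nat \<Rightarrow> (real^2) set" where
  "strip r i = {p. \<bar>p $ 1 - real i\<bar> < r}"

lemma open_strip: "open (strip r i)"
  unfolding strip_def by (intro open_Collect_less continuous_intros)

text \<open>
  The sum of the two half-widths exceeds \<open>1\<close>, which makes neighbours meet, and is less
  than \<open>2\<close>, which keeps other pairs apart.
\<close>

lemma strips_meet_iff:
  assumes "1/2 < r" "r < 1" "1/2 < r'" "r' < 1"
  shows "strip r i \<inter> strip r' j \<noteq> {} \<longleftrightarrow> i \<le> j + 1 \<and> j \<le> i + 1"
proof
  assume "strip r i \<inter> strip r' j \<noteq> {}"
  then obtain p where "p \<in> strip r i" "p \<in> strip r' j"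
    by blast
  then have "\<bar>real i - real j\<bar> < 2"
    using assms unfolding strip_def mem_Collect_eq by linarith
  then show "i \<le> j + 1 \<and> j \<le> i + 1"
    by linarith
next
  assume *: "i \<le> j + 1 \<and> j \<le> i + 1"
  define p :: "real^2" where "p = vec ((real i + real j) / 2)"
  have "\<bar>real i - real j\<bar> \<le> 1"
    using * by linarith
  then have "p \<in> strip r i \<inter> strip r' j"
    using assms by (auto simp: strip_def p_def abs_le_iff abs_less_iff field_simps)
  then show "strip r i \<inter> strip r' j \<noteq> {}"
    by blast
qed

text \<open>
  If \<open>j\<close> lies to the right of \<open>i\<close>, then the strip around \<open>i\<close> contains points to the left of the
  whole strip around \<open>j\<close>. Injectivity is what lets a map on strips be defined through their centres.
\<close>

lemma inj_strip:
  assumes "0 < r"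
  shows "inj (strip r)"
proof -
  have False if "i < j" "strip r i = strip r j" for i j
  proof -
    \<comment> \<open>Any \<open>d\<close> with \<open>- r < d\<close>, \<open>d < r\<close> and \<open>d \<le> 1 - r\<close> would do.\<close>
    define d where "d = min 0 (1 / 2 - r)"
    define p :: "real^2" where "p = vec (real i + d)"
    have "real i + 1 \<le> real j"
      using that(1) by linarith
    moreover have "- r < d" "d < r" "d \<le> 1 - r"
      using assms by (auto simp: d_def)
    ultimately have "p \<in> strip r i" "p \<notin> strip r j"
      by (auto simp: strip_def p_def)
    then show False
      using that(2) by simp
  qed
  then show ?thesis
    by (metis injI linorder_neqE_nat)
qed

lemma closure_strip_subset:
  assumes "r < r'"
  shows "closure (strip r i) \<subseteq> strip r' i"
proof -
  have "closed {p::real^2. \<bar>p $ 1 - real i\<bar> \<le> r}"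
    by (intro closed_Collect_le continuous_intros)
  then have "closure (strip r i) \<subseteq> {p. \<bar>p $ 1 - real i\<bar> \<le> r}"
    by (intro closure_minimal) (auto simp: strip_def)
  then show ?thesis
    using assms by (auto simp: strip_def)
qed

lemma tree_chain_strips:
  assumes "1/2 < r" "r < 1" "N \<ge> 1"
  shows "tree_chain (strip r ` {..N})"
proof (rule tree_chain_linear)
  show "linear_chain (strip r) N"
    using assms inj_strip[of r]
    by unfold_locales (auto simp: strips_meet_iff intro: inj_on_subset)
qed (rule open_strip)

section \<open>Shifting the strips\<close>

theorem theorem3p7:
  fixes n :: nat
  assumes "n \<ge> 1"
  shows "\<exists>(\<U> :: nat \<Rightarrow> (real^2) set set) (\<phi> :: nat \<Rightarrow> (real^2) set \<Rightarrow> (real^2) set).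
     (\<forall>k\<in>{1..n}. tree_chain (\<U> k)) \<and>
     (\<forall>k\<in>{1..n-1}. \<phi> k \<in> \<U> (k+1) \<rightarrow> \<U> k) \<and>
     (\<forall>k\<in>{1..n-1}. strongly_refines (\<U> (k+1)) (\<U> k)) \<and>
     (n \<ge> 2 \<longrightarrow> (\<forall>U\<in>\<U> 1. \<forall>V\<in>\<U> 2. U \<inter> V \<noteq> {} \<longrightarrow> \<phi> 1 V \<inter> U = {})) \<and>
     ((\<forall>k\<in>{1..n-2}. \<forall>U\<in>\<U> (k+2). \<forall>V\<in>\<U> (k+1).
          U \<inter> V \<noteq> {} \<longrightarrow> \<phi> (k+1) U \<inter> \<phi> k V \<noteq> {}) \<or>
      (\<forall>k\<in>{1..n-2}. \<forall>U\<in>\<U> (k+2). \<forall>V\<in>\<U> (k+1).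
          closure U \<subseteq> V \<longrightarrow> \<phi> (k+1) U \<subseteq> \<phi> k V)) \<and>
     (\<forall>k\<in>{1..n-1}. \<forall>U\<in>\<U> (k+1). \<forall>V\<in>\<U> (k+1).
          U \<inter> V \<noteq> {} \<longrightarrow> \<phi> k U \<inter> \<phi> k V \<noteq> {})"
proof -
  \<comment> \<open>Any strictly decreasing sequence between \<open>1/2\<close> and \<open>1\<close> would do.\<close>
  define r :: "nat \<Rightarrow> real" where "r k = 1/2 + 1 / (2 * (real k + 1))" for k
  have r: "1/2 < r k" "r (k + 1) < r k" for k
    by (auto simp: r_def field_simps)
  have r1: "r k < 1" if "k \<ge> 1" for k
    using that by (auto simp: r_def field_simps)
  define \<U> where "\<U> k = strip (r k) ` {..3 * (n - k) + 1}" for k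
  define \<phi> where "\<phi> k V = strip (r k) (inv (strip (r (k + 1))) V + 3)" for k V
  have \<phi>: "\<phi> k (strip (r (Suc k)) i) = strip (r k) (i + 3)" for k i
    using inj_strip[of "r (Suc k)"] r(1)[of "Suc k"] by (simp add: \<phi>_def)
  have meet: "strip (r k) i \<inter> strip (r l) j \<noteq> {} \<longleftrightarrow> i \<le> j + 1 \<and> j \<le> i + 1"
    if "k \<ge> 1" "l \<ge> 1" for k l i j
    using strips_meet_iff r r1 that by blast
  have "\<forall>k\<in>{1..n}. tree_chain (\<U> k)"
    using r r1 by (auto simp: \<U>_def intro!: tree_chain_strips)
  moreover have "\<forall>k\<in>{1..n-1}. \<phi> k \<in> \<U> (k+1) \<rightarrow> \<U> k"
  proof (intro ballI Pi_I)
    fix k V assume k: "k \<in> {1..n-1}" and "V \<in> \<U> (k+1)"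
    then obtain i where i: "i \<le> 3 * (n - (k+1)) + 1" "V = strip (r (Suc k)) i"
      by (auto simp: \<U>_def)
    have "i + 3 \<le> 3 * (n - k) + 1"
      using i k by auto
    then show "\<phi> k V \<in> \<U> k"
      unfolding i(2) \<phi> by (auto simp: \<U>_def)
  qed
  moreover have "\<forall>k\<in>{1..n-1}. strongly_refines (\<U> (k+1)) (\<U> k)"
    unfolding strongly_refines_def
  proof (intro ballI)
    fix k V assume "k \<in> {1..n-1}" and "V \<in> \<U> (k+1)"
    then obtain i where i: "i \<le> 3 * (n - (k+1)) + 1" "V = strip (r (k+1)) i"
      by (auto simp: \<U>_def)
    then have "i \<le> 3 * (n - k) + 1"
      by linarith
    then show "\<exists>U\<in>\<U> k. closure V \<subseteq> U"
      using closure_strip_subset[OF r(2)] i(2) by (auto simp: \<U>_def)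
  qed
  moreover have "\<phi> 1 V \<inter> U = {}" if UV: "U \<in> \<U> 1" "V \<in> \<U> 2" "U \<inter> V \<noteq> {}" for U V
  proof -
    obtain i j where U: "U = strip (r 1) i" and V: "V = strip (r 2) j"
      using UV unfolding \<U>_def by blast
    have "i \<le> j + 1"
      using UV(3) unfolding U V by (simp add: meet)
    moreover have "\<phi> 1 V = strip (r 1) (j + 3)"
      using \<phi>[of 1 j] by (simp add: V numeral_2_eq_2)
    ultimately show ?thesis
      using meet[of 1 1 "j + 3" i] unfolding U by auto
  qed
  moreover have "\<phi> (k+1) U \<inter> \<phi> k V \<noteq> {}"
    if UV: "k \<ge> 1" "U \<in> \<U> (k+2)" "V \<in> \<U> (k+1)" "U \<inter> V \<noteq> {}" for k U V
  proof -
    obtain i j where U: "U = strip (r (Suc (Suc k))) i" and V: "V = strip (r (Suc k)) j"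
      using UV(2,3) by (auto simp: \<U>_def)
    have "i \<le> j + 1 \<and> j \<le> i + 1"
      using UV(1,4) unfolding U V by (simp add: meet)
    then show ?thesis
      using UV(1) unfolding U V by (simp add: \<phi> meet)
  qed
  moreover have "\<phi> k U \<inter> \<phi> k V \<noteq> {}"
    if UV: "k \<ge> 1" "U \<in> \<U> (k+1)" "V \<in> \<U> (k+1)" "U \<inter> V \<noteq> {}" for k U V
  proof -
    obtain i j where U: "U = strip (r (Suc k)) i" and V: "V = strip (r (Suc k)) j"
      using UV(2,3) by (auto simp: \<U>_def)
    have "i \<le> j + 1 \<and> j \<le> i + 1"
      using UV(1,4) unfolding U V by (simp add: meet)
    then show ?thesis
      using UV(1) unfolding U V by (simp add: \<phi> meet)
  qed
  ultimately show ?thesis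
    by (intro exI[of _ \<U>] exI[of _ \<phi>]) auto
qed

end
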